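(* Let $y_1=w_1\varepsilon^{\mu_1}$ and $y_2=w_2\varepsilon^{\mu_2}$ be elements of $S_{n+1}\ltimes\mathbb{Z}\Phi'$. Then $y_1\le y_2$ in the Bruhat order if and only if for all $i,j\in\{1,\dots,n+1\}$, $$(\mu_1+\varpi_i'-w_1^{-1}\varpi_{j-1}')_{\mathrm{dom}}\preceq(\mu_2+\varpi_i'-w_2^{-1}\varpi_{j-1}')_{\mathrm{dom}}.$$
   Context: Fix $n\ge1$. $S_{n+1}$ acts on $\mathbb{Z}^{n+1}$ by $w\cdot(\mu_1,\dots,\mu_{n+1})=(\mu_{w^{-1}(1)},\dots,\mu_{w^{-1}(n+1)})$. Let $\mathbb{Z}\Phi'=\{\mu\in\mathbb{Z}^{n+1}:\sum_i\mu_i=0\}$. The group $S_{n+1}\ltimes\mathbb{Z}\Phi'$ has elements $w\varepsilon^\mu$ ($w\in S_{n+1},\mu\in\mathbb{Z}\Phi'$) with product $(w\varepsilon^\mu)(u\varepsilon^\lambda)=wu\,\varepsilon^{u^{-1}(\mu)+\lambda}$. To $y=w\varepsilon^\mu$ associate the bijection $\pi_y:\mathbb{Z}\to\mathbb{Z}$, $\pi_y(q(n+1)+r)=(q+\mu_r)(n+1)+w(r)$ for $q\in\mathbb{Z}$, $r\in\{1,\dots,n+1\}$; $y\mapsto\pi_y$ is a group isomorphism onto the affine symmetric group $\widetilde S_{n+1}$ of bijections $\pi:\mathbb{Z}\to\mathbb{Z}$ with $\pi(t+n+1)=\pi(t)+n+1$ and $\sum_{t=1}^{n+1}\pi(t)=\binom{n+2}{2}$.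 $\widetilde S_{n+1}$ is a Coxeter group with generators $s_i$ ($1\le i\le n$) given in window notation $[\pi(1),\dots,\pi(n+1)]$ by swapping $i,i+1$ in $[1,\dots,n+1]$, and $s_0=[0,2,3,\dots,n,n+2]$; the Bruhat order on $S_{n+1}\ltimes\mathbb{Z}\Phi'$ is the one transported via $y\mapsto\pi_y$. Let $\varpi_i'=(1,\dots,1,0,\dots,0)\in\mathbb{Z}^{n+1}$ with $i$ ones ($0\le i\le n+1$). For $\mu,\mu'\in\mathbb{Z}^{n+1}$, $\mu\preceq\mu'$ iff $\sum_{i=1}^{n+1}\mu_i=\sum_{i=1}^{n+1}\mu'_i$ and $\sum_{i=1}^m\mu_i\le\sum_{i=1}^m\mu'_i$ for all $m$. $\mu_{\mathrm{dom}}$ denotes the unique weakly decreasing rearrangement of $\mu$. *)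

theory Defs
  imports "HOL-Algebra.Group" "HOL-Combinatorics.Permutations"
begin

text \<open>
  Vectors in \<open>\<int>\<^bsup>n+1\<^esup>\<close> are functions \<^typ>\<open>nat \<Rightarrow> int\<close> vanishing outside \<open>{1..n+1}\<close>, and
  elements of \<open>S\<^bsub>n+1\<^esub>\<close> are functions \<^typ>\<open>nat \<Rightarrow> nat\<close> permuting \<open>{1..n+1}\<close>. The inverse of
  such a function is written \<open>inv_into UNIV w\<close>, because HOL-Algebra uses \<open>inv\<close> for the
  inverse in a group record.
\<close>

definition int_vecs :: "nat \<Rightarrow> (nat \<Rightarrow> int) set" where
  "int_vecs n = {\<mu>. \<forall>i. i \<notin> {1..n+1} \<longrightarrow> \<mu> i = 0}"

definition root_lattice :: "nat \<Rightarrow> (nat \<Rightarrow> int) set" where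
  "root_lattice n = {\<mu> \<in> int_vecs n. (\<Sum>i=1..n+1. \<mu> i) = 0}"

definition perm_act :: "(nat \<Rightarrow> nat) \<Rightarrow> (nat \<Rightarrow> int) \<Rightarrow> nat \<Rightarrow> int" where
  "perm_act w \<mu> = (\<lambda>i. \<mu> (inv_into UNIV w i))"

definition fund_weight :: "nat \<Rightarrow> nat \<Rightarrow> int" where
  "fund_weight i = (\<lambda>k. if 1 \<le> k \<and> k \<le> i then 1 else 0)"

text \<open>The pair \<open>(w, \<mu>)\<close> stands for \<open>w \<epsilon>\<^sup>\<mu>\<close>.\<close>

definition semidirect :: "nat \<Rightarrow> ((nat \<Rightarrow> nat) \<times> (nat \<Rightarrow> int)) monoid" where
  "semidirect n =
    \<lparr>carrier = {w. w permutes {1..n+1}} \<times> root_lattice n,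
     monoid.mult = (\<lambda>(w, \<mu>) (u, \<nu>). (w \<circ> u, \<lambda>k. perm_act (inv_into UNIV u) \<mu> k + \<nu> k)),
     one = (id, \<lambda>_. 0)\<rparr>"

definition affine_sym :: "nat \<Rightarrow> (int \<Rightarrow> int) monoid" where
  "affine_sym n =
    \<lparr>carrier = {\<pi>. bij \<pi> \<and> (\<forall>t. \<pi> (t + int (n+1)) = \<pi> t + int (n+1)) \<and>
       (\<Sum>t=1..int (n+1). \<pi> t) = int ((n+2) choose 2)},
     monoid.mult = (\<circ>),
     one = id\<rparr>"

text \<open>
  The map \<open>\<pi> : \<int> \<rightarrow> \<int>\<close> with window \<open>[f 1, \<dots>, f (n+1)]\<close>: for \<open>r \<in> {1..n+1}\<close> it sends
  \<open>q (n+1) + r\<close> to \<open>q (n+1) + f r\<close>.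
\<close>

definition of_window :: "nat \<Rightarrow> (nat \<Rightarrow> int) \<Rightarrow> int \<Rightarrow> int" where
  "of_window n f t =
    ((t - 1) div int (n+1)) * int (n+1) + f (nat ((t - 1) mod int (n+1)) + 1)"

definition affine_perm :: "nat \<Rightarrow> (nat \<Rightarrow> nat) \<times> (nat \<Rightarrow> int) \<Rightarrow> int \<Rightarrow> int" where
  "affine_perm n y = of_window n (\<lambda>r. snd y r * int (n+1) + int (fst y r))"

definition affine_gen :: "nat \<Rightarrow> nat \<Rightarrow> int \<Rightarrow> int" where
  "affine_gen n i =
    of_window n (if i = 0
      then (\<lambda>r. if r = 1 then 0 else if r = n+1 then int n + 2 else int r)
      else (\<lambda>r. int (Transposition.transpose i (i+1) r)))"

definition affine_gens :: "nat \<Rightarrow> (int \<Rightarrow> int) set" where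
  "affine_gens n = affine_gen n ` {0..n}"

lemma of_window_eq:
  assumes "r \<in> {1..n+1}"
  shows "of_window n f (q * int (n+1) + int r) = q * int (n+1) + f r"
proof -
  have *: "0 \<le> int r - 1" "int r - 1 < int (n+1)" using assms by auto
  have "q * int (n+1) + int r - 1 = (int r - 1) + q * int (n+1)" by simp
  then have "(q * int (n+1) + int r - 1) div int (n+1) = q"
    "(q * int (n+1) + int r - 1) mod int (n+1) = int r - 1"
    using * by (simp_all only: div_mult_self1 mod_mult_self1 div_pos_pos_trivial mod_pos_pos_trivial)
  then show ?thesis
    using assms by (simp add: of_window_def nat_diff_distrib)
qed

text \<open>Length, reflections and Bruhat order of a group \<open>G\<close> with generating set \<open>S\<close> of involutions.\<close>

definition cox_length :: "('a, 'b) monoid_scheme \<Rightarrow> 'a set \<Rightarrow> 'a \<Rightarrow> nat" where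
  "cox_length G S x =
    (LEAST k. \<exists>ss. set ss \<subseteq> S \<and> length ss = k \<and> foldr (monoid.mult G) ss \<one>\<^bsub>G\<^esub> = x)"

definition reflections :: "('a, 'b) monoid_scheme \<Rightarrow> 'a set \<Rightarrow> 'a set" where
  "reflections G S = {x \<otimes>\<^bsub>G\<^esub> s \<otimes>\<^bsub>G\<^esub> inv\<^bsub>G\<^esub> x | x s. x \<in> carrier G \<and> s \<in> S}"

definition bruhat_step :: "('a, 'b) monoid_scheme \<Rightarrow> 'a set \<Rightarrow> 'a \<Rightarrow> 'a \<Rightarrow> bool" where
  "bruhat_step G S u v \<longleftrightarrow>
    u \<in> carrier G \<and> (\<exists>t \<in> reflections G S. v = u \<otimes>\<^bsub>G\<^esub> t) \<and> cox_length G S u < cox_length G S v"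

definition bruhat_le :: "('a, 'b) monoid_scheme \<Rightarrow> 'a set \<Rightarrow> 'a \<Rightarrow> 'a \<Rightarrow> bool" where
  "bruhat_le G S = (bruhat_step G S)\<^sup>*\<^sup>*"

definition bruhat_semidirect ::
  "nat \<Rightarrow> (nat \<Rightarrow> nat) \<times> (nat \<Rightarrow> int) \<Rightarrow> (nat \<Rightarrow> nat) \<times> (nat \<Rightarrow> int) \<Rightarrow> bool" where
  "bruhat_semidirect n y y' \<longleftrightarrow>
    bruhat_le (affine_sym n) (affine_gens n) (affine_perm n y) (affine_perm n y')"

definition dominance_le :: "nat \<Rightarrow> (nat \<Rightarrow> int) \<Rightarrow> (nat \<Rightarrow> int) \<Rightarrow> bool" where
  "dominance_le n \<mu> \<mu>' \<longleftrightarrow>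
    (\<Sum>i=1..n+1. \<mu> i) = (\<Sum>i=1..n+1. \<mu>' i) \<and>
    (\<forall>m\<in>{1..n+1}. (\<Sum>i=1..m. \<mu> i) \<le> (\<Sum>i=1..m. \<mu>' i))"

definition is_dom_of :: "nat \<Rightarrow> (nat \<Rightarrow> int) \<Rightarrow> (nat \<Rightarrow> int) \<Rightarrow> bool" where
  "is_dom_of n \<mu> \<nu> \<longleftrightarrow>
    \<nu> \<in> int_vecs n \<and>
    (\<forall>i\<in>{1..n+1}. \<forall>j\<in>{1..n+1}. i \<le> j \<longrightarrow> \<nu> j \<le> \<nu> i) \<and>
    (\<exists>\<sigma>. \<sigma> permutes {1..n+1} \<and> (\<forall>i\<in>{1..n+1}. \<nu> i = \<mu> (\<sigma> i)))"

definition dom_rearr :: "nat \<Rightarrow> (nat \<Rightarrow> int) \<Rightarrow> nat \<Rightarrow> int" where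
  "dom_rearr n \<mu> = (THE \<nu>. is_dom_of n \<mu> \<nu>)"

lemma ex1_is_dom_of: "\<exists>!\<nu>. is_dom_of n \<mu> \<nu>"
proof -
  define xs where "xs = map \<mu> [1..<n+2]"
  define ys where "ys = rev (sort xs)"
  have len: "length xs = n+1" "length ys = n+1"
    by (simp_all add: xs_def ys_def)
  have char: "is_dom_of n \<mu> \<nu> \<longleftrightarrow> \<nu> \<in> int_vecs n \<and> map \<nu> [1..<n+2] = ys" for \<nu>
  proof -
    define zs where "zs = map \<nu> [1..<n+2]"
    have lz: "length zs = n+1" by (simp add: zs_def)
    have ivl: "{1..<n+2} = {1..n+1}" by auto
    have sorted: "(\<forall>i\<in>{1..n+1}. \<forall>j\<in>{1..n+1}. i \<le> j \<longrightarrow> \<nu> j \<le> \<nu> i) \<longleftrightarrow> sorted (rev zs)"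
    proof -
      have "sorted (rev zs) \<longleftrightarrow> sorted_wrt (\<ge>) zs"
        by (simp add: sorted_wrt_rev)
      also have "\<dots> \<longleftrightarrow> (\<forall>i j. i \<le> j \<longrightarrow> j < n+1 \<longrightarrow> \<nu> (Suc j) \<le> \<nu> (Suc i))"
        unfolding sorted_wrt_iff_nth_less lz
        by (auto simp: zs_def nth_append le_less simp del: upt_Suc)
      also have "\<dots> \<longleftrightarrow> (\<forall>i\<in>{1..n+1}. \<forall>j\<in>{1..n+1}. i \<le> j \<longrightarrow> \<nu> j \<le> \<nu> i)"
      proof safe
        fix i j assume *: "\<forall>i j. i \<le> j \<longrightarrow> j < n+1 \<longrightarrow> \<nu> (Suc j) \<le> \<nu> (Suc i)"
          and "i \<in> {1..n+1}" "j \<in> {1..n+1}" "i \<le> j"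
        then show "\<nu> j \<le> \<nu> i"
          using *[rule_format, of "i-1" "j-1"] by auto
      qed auto
      finally show ?thesis by blast
    qed
    have "(\<exists>\<sigma>. \<sigma> permutes {1..n+1} \<and> (\<forall>i\<in>{1..n+1}. \<nu> i = \<mu> (\<sigma> i))) \<longleftrightarrow>
      image_mset \<mu> (mset_set {1..n+1}) = image_mset \<nu> (mset_set {1..n+1})"
    proof
      assume "\<exists>\<sigma>. \<sigma> permutes {1..n+1} \<and> (\<forall>i\<in>{1..n+1}. \<nu> i = \<mu> (\<sigma> i))"
      then obtain \<sigma> where s: "\<sigma> permutes {1..n+1}" "\<forall>i\<in>{1..n+1}. \<nu> i = \<mu> (\<sigma> i)" by blast
      have "image_mset \<nu> (mset_set {1..n+1}) = image_mset (\<mu> \<circ> \<sigma>) (mset_set {1..n+1})"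
        using s(2) by (intro image_mset_cong) auto
      also have "\<dots> = image_mset \<mu> (image_mset \<sigma> (mset_set {1..n+1}))"
        by (simp add: image_mset.compositionality)
      also have "image_mset \<sigma> (mset_set {1..n+1}) = mset_set {1..n+1}"
        using s(1) by (metis image_mset_mset_set permutes_image permutes_inj_on)
      finally show "image_mset \<mu> (mset_set {1..n+1}) = image_mset \<nu> (mset_set {1..n+1})" by simp
    next
      assume "image_mset \<mu> (mset_set {1..n+1}) = image_mset \<nu> (mset_set {1..n+1})"
      then obtain \<sigma> where "\<sigma> permutes {1..n+1}" "\<forall>x\<in>{1..n+1}. \<nu> x = \<mu> (\<sigma> x)"
        using image_mset_eq_implies_permutes[of "{1..n+1}" \<nu> \<mu>] by auto
      then show "\<exists>\<sigma>. \<sigma> permutes {1..n+1} \<and> (\<forall>i\<in>{1..n+1}. \<nu> i = \<mu> (\<sigma> i))" by blast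
    qed
    also have "\<dots> \<longleftrightarrow> mset xs = mset zs"
      unfolding xs_def zs_def mset_map mset_upt ivl by blast
    finally have perm: "(\<exists>\<sigma>. \<sigma> permutes {1..n+1} \<and> (\<forall>i\<in>{1..n+1}. \<nu> i = \<mu> (\<sigma> i))) \<longleftrightarrow>
      mset xs = mset zs" .
    have "sorted (rev zs) \<and> mset xs = mset zs \<longleftrightarrow> zs = ys"
      unfolding ys_def by (metis mset_rev mset_sort properties_for_sort rev_rev_ident sorted_sort)
    with sorted perm show ?thesis
      unfolding is_dom_of_def zs_def by blast
  qed
  define \<nu>0 where "\<nu>0 i = (if i \<in> {1..n+1} then ys ! (i-1) else 0)" for i
  have "\<nu>0 \<in> int_vecs n" by (auto simp: \<nu>0_def int_vecs_def)
  moreover have "map \<nu>0 [1..<n+2] = ys"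
    by (rule nth_equalityI) (auto simp: len \<nu>0_def nth_append simp del: upt_Suc)
  moreover have "\<nu> = \<nu>'" if "\<nu> \<in> int_vecs n" "map \<nu> [1..<n+2] = ys"
    "\<nu>' \<in> int_vecs n" "map \<nu>' [1..<n+2] = ys" for \<nu> \<nu>'
  proof
    fix i
    have "map \<nu> [1..<n+2] = map \<nu>' [1..<n+2]" using that by simp
    then have "\<forall>x\<in>set [1..<n+2]. \<nu> x = \<nu>' x" by (simp only: map_eq_conv)
    then show "\<nu> i = \<nu>' i"
      using that(1,3) by (cases "i \<in> {1..n+1}") (auto simp: int_vecs_def simp del: upt_Suc)
  qed
  ultimately show ?thesis unfolding char by blast
qed

end

theory Submission
  imports Defs
begin

text \<open>
  Write \<open>N = n + 1\<close> and \<open>\<pi>[i, j] = #{x \<le> i. \<pi> x \<ge> j}\<close>. Counting residue by residue, \<open>\<pi>\<^bsub>y\<^esub>[i + m N, j]\<close>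
  is the sum over \<open>k\<close> of the positive parts of \<open>m + \<nu>\<^sub>k\<close>, where \<open>\<nu> = \<mu> + \<varpi>'\<^sub>i - w\<^sup>-\<^sup>1 \<varpi>'\<^bsub>j-1\<^esub>\<close>.
  For vectors with equal totals, dominance of the decreasing rearrangements is the same as the
  inequality of all these sums, so the claim becomes: \<open>u \<le> v\<close> iff \<open>u[i, j] \<le> v[i, j]\<close> for all
  integers \<open>i\<close>, \<open>j\<close>.

  By strong exchange, \<open>u < u t\<close> for the transposition \<open>t\<close> of \<open>a < b\<close> exactly when \<open>u a < u b\<close>, and then
  crossing numbers can only grow. Conversely, let \<open>s\<close> be a descent of \<open>v\<close>. The inequalities for
  \<open>(u, v)\<close> imply those for \<open>(u s, v s)\<close> if \<open>s\<close> is also a descent of \<open>u\<close>, and those for \<open>(u, v s)\<close>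
  otherwise; induction on \<open>v\<close> together with the lifting property concludes.
\<close>

lemma sum_upto_int: "(\<Sum>t=1..int m. t) = int ((m + 1) choose 2)"
proof (induction m)
  case (Suc m)
  have "{1..int (Suc m)} = insert (int (Suc m)) {1..int m}" by auto
  then have "(\<Sum>t=1..int (Suc m). t) = int (Suc m) + (\<Sum>t=1..int m. t)" by simp
  then show ?case using Suc by (simp add: numeral_2_eq_2)
qed simp

section \<open>The affine symmetric group acting on the integers\<close>

locale affine_symmetric =
  fixes n :: nat
  assumes n_pos: "n \<ge> 1"
begin

definition N :: int where "N = int (n + 1)"

lemma N_ge_2: "N \<ge> 2"
  using n_pos by (simp add: N_def)

definition W :: "(int \<Rightarrow> int) set" where "W = carrier (affine_sym n)"

definition periodic :: "(int \<Rightarrow> int) \<Rightarrow> bool" where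
  "periodic u \<longleftrightarrow> (\<forall>t. u (t + N) = u t + N)"

text \<open>For \<open>a\<close> and \<open>b\<close> incongruent modulo \<open>N\<close> this is
  the affine transposition exchanging \<open>a + k * N\<close> with \<open>b + k * N\<close> for
  every \<open>k\<close>.\<close>

definition tr :: "int \<Rightarrow> int \<Rightarrow> int \<Rightarrow> int" where
  "tr a b x = (if N dvd x - a then x - a + b else if N dvd x - b then x - b + a else x)"

text \<open>The number \<open>u[i, j]\<close> of the overview. Since \<open>card\<close> is 0 on
  infinite sets, the definition is meaningful only together with
  \<open>finite_crossings\<close>.\<close>

definition cross :: "(int \<Rightarrow> int) \<Rightarrow> int \<Rightarrow> int \<Rightarrow> nat" where
  "cross u i j = card {x. x \<le> i \<and> j \<le> u x}"

subsection \<open>Periodic functions\<close>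

text \<open>The drift \<open>d\<close> is left free so that \<open>d = N\<close> covers affine
  permutations and \<open>d = 0\<close> covers functions of the residue.\<close>

lemma periodic_shift:
  assumes "\<And>t. g (t + N) = g t + (d :: int)"
  shows "g (t + k * N) = g t + k * d"
proof (induction k rule: int_induct[where k = 0])
  case (step1 i)
  have "g (t + (i + 1) * N) = g (t + i * N) + d"
    using assms[of "t + i * N"] by (simp add: algebra_simps)
  then show ?case using step1 by (simp add: algebra_simps)
next
  case (step2 i)
  have "g (t + i * N) = g (t + (i - 1) * N) + d"
    using assms[of "t + (i - 1) * N"] by (simp add: algebra_simps)
  then show ?case using step2 by (simp add: algebra_simps)
qed simp

lemma periodic_mult: "periodic u \<Longrightarrow> u (t + k * N) = u t + k * N"
  unfolding periodic_def by (rule periodic_shift) blast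

text \<open>A congruence of values reads \<open>u x = u (y + k * N)\<close>, and injectivity cancels
  \<open>u\<close>. Hence \<open>u\<close> acts injectively on residues.\<close>

lemma periodic_dvd_iff:
  assumes "periodic u" "inj u"
  shows "N dvd u x - u y \<longleftrightarrow> N dvd x - y"
proof
  assume "N dvd u x - u y"
  then obtain k where "u x = u y + k * N"
    by (metis add.commute diff_add_cancel dvdE mult.commute)
  then have "u x = u (y + k * N)" using periodic_mult[OF assms(1)] by simp
  then have "x = y + k * N" using assms(2) by (simp add: inj_eq)
  then show "N dvd x - y" by simp
next
  assume "N dvd x - y"
  then obtain k where "x = y + k * N"
    by (metis add.commute diff_add_cancel dvdE mult.commute)
  then show "N dvd u x - u y" using periodic_mult[OF assms(1)] by simp
qed

lemma window_unique:
  assumes "x \<in> {1..N}" "y \<in> {1..N}" "N dvd x - y"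
  shows "x = y"
proof -
  have "\<bar>x - y\<bar> < N" using assms by auto
  then show ?thesis using assms(3) zdvd_not_zless[of "\<bar>x - y\<bar>" N] by auto
qed

lemma decompE:
  fixes x :: int
  obtains q r where "r \<in> {1..n + 1}" "x = q * N + int r"
proof (rule that)
  have m: "0 \<le> (x - 1) mod N" "(x - 1) mod N < N"
    using N_ge_2 by simp_all
  then have "nat ((x - 1) mod N) < n + 1" by (metis N_def nat_less_iff)
  then show "nat ((x - 1) mod N) + 1 \<in> {1..n + 1}" by simp
  show "x = (x - 1) div N * N + int (nat ((x - 1) mod N) + 1)"
    using m by simp
qed

text \<open>\<open>v\<close> permutes the residues modulo \<open>N\<close>, and \<open>g\<close>
  depends only on the residue.\<close>

lemma sum_window_reindex:
  assumes v: "periodic v" "inj v" and g: "\<And>t. g (t + N) = (g t :: int)"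
  shows "(\<Sum>t=1..N. g (v t)) = (\<Sum>t=1..N. g t)"
proof -
  \<comment> \<open>The representative of \<open>v t\<close> in \<open>{1..N}\<close>; the shifts by
    one make \<open>N\<close>, and not 0, stand for the zero class.\<close>
  define f where "f t = (v t - 1) mod N + 1" for t
  have gf: "g (f t) = g (v t)" for t
  proof -
    have "v t = f t + ((v t - 1) div N) * N"
      unfolding f_def by (simp add: algebra_simps)
    then show ?thesis using periodic_shift[of g 0] g by (metis add.right_neutral mult_zero_right)
  qed
  have "f ` {1..N} \<subseteq> {1..N}"
    using N_ge_2 pos_mod_bound[of N] unfolding f_def by (auto simp: add1_zle_eq)
  moreover have "inj_on f {1..N}"
  proof (rule inj_onI)
    fix x y assume xy: "x \<in> {1..N}" "y \<in> {1..N}" "f x = f y"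
    then have "N dvd v x - v y"
      unfolding f_def by (auto simp: mod_eq_dvd_iff)
    with xy v show "x = y" using window_unique periodic_dvd_iff by blast
  qed
  ultimately have "bij_betw f {1..N} {1..N}"
    by (simp add: bij_betw_def endo_inj_surj)
  then have "(\<Sum>t=1..N. g (f t)) = (\<Sum>t=1..N. g t)"
    by (rule sum.reindex_bij_betw)
  then show ?thesis by (simp add: gf)
qed

text \<open>Every residue class meets the window exactly once.\<close>

lemma sum_two_classes:
  assumes "\<not> N dvd b - a"
  shows "(\<Sum>t=1..N. if N dvd t - a then \<alpha> else if N dvd t - b then \<beta> else 0) = \<alpha> + (\<beta> :: int)"
proof -
  have one: "(\<Sum>t=1..N. if N dvd t - c then \<gamma> else 0) = (\<gamma> :: int)" for c \<gamma>
  proof -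
    define t0 where "t0 = (c - 1) mod N + 1"
    have t0: "t0 \<in> {1..N}"
      using N_ge_2 pos_mod_bound[of N "c - 1"] pos_mod_sign[of N "c - 1"] unfolding t0_def by (auto simp del: pos_mod_bound)
    have d: "N dvd t0 - c"
      unfolding t0_def using dvd_minus_mod[of N "c - 1"] dvd_diff_commute[of N "c - 1" "(c - 1) mod N"]
      by (simp add: algebra_simps)
    have "N dvd t - c \<longleftrightarrow> t = t0" if "t \<in> {1..N}" for t
      using window_unique[OF that t0] d dvd_diff[of N "t - c" "t0 - c"] by auto
    then have "(\<Sum>t=1..N. if N dvd t - c then \<gamma> else 0) = (\<Sum>t=1..N. if t = t0 then \<gamma> else 0)"
      by (intro sum.cong) auto
    then show ?thesis using t0 by simp
  qed
  have "(if N dvd t - a then \<alpha> else if N dvd t - b then \<beta> else 0)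
    = (if N dvd t - a then \<alpha> else 0) + (if N dvd t - b then \<beta> else 0)" for t
    using assms dvd_diff[of N "t - a" "t - b"] by auto
  then show ?thesis by (simp add: sum.distrib one)
qed

subsection \<open>The group\<close>

text \<open>Normalising by displacements makes the summand periodic, so that
  \<open>sum_window_reindex\<close> applies to it.\<close>

lemma W_iff: "u \<in> W \<longleftrightarrow> bij u \<and> periodic u \<and> (\<Sum>t=1..N. u t - t) = 0"
  using sum_upto_int[of "n + 1"]
  unfolding W_def affine_sym_def periodic_def N_def
  by (auto simp: sum_subtractf)

lemma W_inj: "u \<in> W \<Longrightarrow> inj u" and W_periodic: "u \<in> W \<Longrightarrow> periodic u" and W_bij: "u \<in> W \<Longrightarrow> bij u"
  by (auto simp: W_iff bij_is_inj)

lemma displacement_periodic: "periodic u \<Longrightarrow> u (t + N) - (t + N) = u t - t"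
  by (simp add: periodic_def)

lemma id_in_W: "id \<in> W"
  by (simp add: W_iff periodic_def)

lemma comp_in_W:
  assumes "u \<in> W" "v \<in> W"
  shows "u \<circ> v \<in> W"
proof -
  have "(\<Sum>t=1..N. u (v t) - v t) = 0"
    using sum_window_reindex[of v "\<lambda>t. u t - t"] displacement_periodic[of u] assms W_inj
    by (simp add: W_iff)
  \<comment> \<open>The displacement of a composition splits in two; reindexing by \<open>v\<close>
    has just shown that the first part vanishes.\<close>
  moreover have "(\<Sum>t=1..N. u (v t) - t) = (\<Sum>t=1..N. u (v t) - v t) + (\<Sum>t=1..N. v t - t)"
    by (simp add: sum.distrib[symmetric])
  ultimately show ?thesis
    using assms by (auto simp: W_iff periodic_def bij_comp)
qed

lemma inv_in_W:
  assumes "u \<in> W"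
  shows "inv_into UNIV u \<in> W"
proof -
  have b: "bij u" and p: "periodic u" using assms by (auto simp: W_iff)
  let ?v = "inv_into UNIV u"
  have uv: "u (?v t) = t" and vu: "?v (u t) = t" for t
    using b by (simp_all add: bij_is_inj bij_is_surj surj_f_inv_f)
  have pv: "periodic ?v"
    unfolding periodic_def
  proof
    fix t
    have "u (?v t + N) = t + N" using p uv by (simp add: periodic_def)
    then show "?v (t + N) = ?v t + N" using vu by metis
  qed
  have "(\<Sum>t=1..N. ?v t - t) = (\<Sum>t=1..N. ?v (u t) - u t)"
    using sum_window_reindex[of u "\<lambda>t. ?v t - t"] displacement_periodic[OF pv] p W_inj[OF assms]
    by simp
  also have "\<dots> = - (\<Sum>t=1..N. u t - t)" by (simp add: vu sum_negf[symmetric])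
  finally show ?thesis using assms b pv by (auto simp: W_iff bij_imp_bij_inv)
qed

lemma m_inv_eq:
  assumes "u \<in> W"
  shows "inv\<^bsub>affine_sym n\<^esub> u = inv_into UNIV u"
proof -
  have b: "bij u" using assms by (rule W_bij)
  have c: "u \<circ> inv_into UNIV u = id" "inv_into UNIV u \<circ> u = id"
    using b by (auto simp: fun_eq_iff bij_is_inj bij_is_surj surj_f_inv_f)
  have uniq: "y = inv_into UNIV u" if "u \<circ> y = id" for y
    using that c by (metis comp_assoc comp_id id_comp)
  have ops: "monoid.mult (affine_sym n) = (\<circ>)" "\<one>\<^bsub>affine_sym n\<^esub> = id"
    by (simp_all add: affine_sym_def)
  show ?thesis
    unfolding m_inv_def ops
  proof (rule the_equality)
    show "inv_into UNIV u \<in> carrier (affine_sym n) \<and> u \<circ> inv_into UNIV u = id \<and> inv_into UNIV u \<circ> u = id"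
      using c inv_in_W[OF assms] unfolding W_def by blast
  qed (use uniq in blast)
qed

subsection \<open>Affine transpositions\<close>

lemma dvd_diffE:
  assumes "N dvd x - a"
  obtains k where "x = a + k * N"
  using assms by (metis add.commute diff_add_cancel dvdE mult.commute)

lemma not_dvd_1: "\<not> N dvd 1"
  using N_ge_2 by auto

lemma tr_shift_left [simp]: "tr a b (a + k * N) = b + k * N"
  by (simp add: tr_def)

lemma tr_shift_right:
  assumes "\<not> N dvd b - a"
  shows "tr a b (b + k * N) = a + k * N"
proof -
  have "b + k * N - a = (b - a) + k * N" by simp
  then have "\<not> N dvd b + k * N - a"
    using assms by (metis dvd_add_left_iff dvd_triv_right)
  then show ?thesis by (simp add: tr_def)
qed

lemma tr_left [simp]: "tr a b a = b"
  by (simp add: tr_def)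

lemma tr_right: "\<not> N dvd b - a \<Longrightarrow> tr a b b = a"
  by (simp add: tr_def)

lemma tr_other: "\<not> N dvd x - a \<Longrightarrow> \<not> N dvd x - b \<Longrightarrow> tr a b x = x"
  by (simp add: tr_def)

lemma tr_cases:
  assumes "\<not> N dvd b - a"
  obtains k where "x = a + k * N" "tr a b x = b + k * N"
  | k where "x = b + k * N" "tr a b x = a + k * N"
  | "\<not> N dvd x - a" "\<not> N dvd x - b" "tr a b x = x"
  using assms tr_shift_right[OF assms] tr_shift_left tr_other by (metis dvd_diffE)

lemma tr_tr [simp]:
  assumes "\<not> N dvd b - a"
  shows "tr a b (tr a b x) = x"
  using assms by (cases rule: tr_cases[OF assms, of x]) (simp_all add: tr_shift_right)

lemma tr_comp_tr: "\<not> N dvd b - a \<Longrightarrow> tr a b \<circ> tr a b = id"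
  by (simp add: fun_eq_iff)

lemma tr_commute: "\<not> N dvd b - a \<Longrightarrow> tr a b = tr b a"
  using dvd_diff[of N "_ - a" "_ - b"] by (fastforce simp: tr_def fun_eq_iff)

lemma tr_translate: "tr (a + k * N) (b + k * N) = tr a b"
proof -
  have "N dvd x - (c + k * N) \<longleftrightarrow> N dvd x - c" for x c
    by (metis diff_diff_eq dvd_diff_right_iff dvd_triv_right diff_add_cancel dvd_add_left_iff)
  then show ?thesis by (auto simp: tr_def fun_eq_iff)
qed

lemma tr_add_N: "tr a b (x + N) = tr a b x + N"
proof -
  have "N dvd x + N - c \<longleftrightarrow> N dvd x - c" for c
    by (metis add_diff_eq add.commute dvd_add_triv_left_iff)
  then show ?thesis by (simp add: tr_def)
qed

lemma tr_in_W:
  assumes "\<not> N dvd b - a"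
  shows "tr a b \<in> W"
proof -
  have "bij (tr a b)"
    using assms by (intro o_bij[of "tr a b"]) (simp_all add: tr_comp_tr)
  moreover have "tr a b t - t = (if N dvd t - a then b - a else if N dvd t - b then a - b else 0)" for t
    by (simp add: tr_def)
  ultimately show ?thesis
    using sum_two_classes[OF assms, of "b - a" "a - b"] by (simp add: W_iff periodic_def tr_add_N)
qed

text \<open>Conjugating a transposition by \<open>u\<close> relabels its two points:
  \<open>u\<close> preserves congruence and commutes with shifts by multiples of
  \<open>N\<close>.\<close>

lemma conj_tr:
  assumes "u \<in> W"
  shows "u (tr a b x) = tr (u a) (u b) (u x)"
proof -
  have "u (x - c + d) = u x - u c + u d" if dvd: "N dvd x - c" for c d
  proof -
    obtain k where "x = c + k * N" using dvd by (rule dvd_diffE)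
    then show ?thesis using periodic_mult[OF W_periodic[OF assms]] by (simp add: add.commute)
  qed
  then show ?thesis
    using periodic_dvd_iff[OF W_periodic W_inj, OF assms assms] by (simp add: tr_def)
qed

lemma comp_tr: "u \<in> W \<Longrightarrow> u \<circ> tr a b = tr (u a) (u b) \<circ> u"
  by (simp add: fun_eq_iff conj_tr)

section \<open>Adjacent transpositions, generators and reflections\<close>

lemma tr_Suc_cases:
  obtains "N dvd x - c" "tr c (c + 1) x = x + 1"
  | "N dvd x - (c + 1)" "tr c (c + 1) x = x - 1"
  | "\<not> N dvd x - c" "\<not> N dvd x - (c + 1)" "tr c (c + 1) x = x"
  by (cases "N dvd x - c"; cases "N dvd x - (c + 1)") (simp_all add: tr_def)

lemma tr_Suc_eq: "N dvd x - c \<Longrightarrow> tr c (c + 1) = tr x (x + 1)"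
  using tr_translate[of c _ "c + 1"] by (metis add.assoc add.commute dvd_diffE)

text \<open>Points move by at most one, so outside the excluded case order is preserved weakly;
  injectivity makes it strict.\<close>

lemma tr_Suc_less:
  assumes "x < y" "\<not> (N dvd x - c \<and> y = x + 1)"
  shows "tr c (c + 1) x < tr c (c + 1) y"
proof -
  have "inj (tr c (c + 1))" using tr_in_W[of "c + 1" c] not_dvd_1 W_inj by simp
  then have "tr c (c + 1) x \<noteq> tr c (c + 1) y" using assms(1) by (simp add: inj_eq)
  then show ?thesis
    using assms by (cases rule: tr_Suc_cases[of x c]; cases rule: tr_Suc_cases[of y c]) auto
qed

text \<open>Each generator, \<open>s_0\<close> included, exchanges \<open>i\<close> and
  \<open>i + 1\<close> modulo \<open>N\<close>, and every integer \<open>c\<close> is congruent to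
  some \<open>i\<close> in \<open>{0..n}\<close>.\<close>

lemma affine_gens_eq: "affine_gens n = range (\<lambda>c. tr c (c + 1))"
proof -
  have gen: "affine_gen n i = tr (int i) (int i + 1)" if "i \<le> n" for i
  proof
    fix x
    obtain q r where r: "r \<in> {1..n + 1}" and x: "x = q * N + int r" by (rule decompE)
    have small: "N dvd y \<longleftrightarrow> y = 0" if "- N < y" "y < N" for y
      using that dvd_imp_le_int[of y N] by (cases "y = 0") (auto simp: abs_if split: if_splits)
    have d: "N dvd x - c \<longleftrightarrow> N dvd int r - c" for c
      unfolding x by (metis add_diff_eq add.commute dvd_add_right_iff dvd_triv_right)
    have ow: "of_window n f x = q * N + f r" for f
      using of_window_eq[OF r, of f q] x by (simp add: N_def)
    show "affine_gen n i x = tr (int i) (int i + 1) x"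
    proof (cases "i = 0")
      case True
      \<comment> \<open>The class of 0 is represented by \<open>n + 1\<close>, which lies just
        outside the range of \<open>small\<close> and is treated separately.\<close>
      have 0: "N dvd int r \<longleftrightarrow> r = n + 1"
        using r small[of "int r"] by (cases "r = n + 1") (auto simp: N_def)
      have 1: "N dvd int r - 1 \<longleftrightarrow> r = 1"
        using r by (subst small) (auto simp: N_def)
      have "affine_gen n i x = q * N + (if r = 1 then 0 else if r = n + 1 then int n + 2 else int r)"
        by (simp add: affine_gen_def ow True)
      moreover have "tr (int i) (int i + 1) x = (if r = n + 1 then x + 1 else if r = 1 then x - 1 else x)"
        using d[of 0] d[of 1] 0 1 by (simp add: tr_def True)
      \<comment> \<open>The two case distinctions test \<open>r = 1\<close> and
        \<open>r = n + 1\<close> in opposite order; they agree because \<open>n \<ge> 1\<close>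
        keeps these positions apart.\<close>
      ultimately show ?thesis
        using n_pos by (auto simp: x N_def)
    next
      case False
      have 0: "N dvd int r - int i \<longleftrightarrow> r = i"
        using r that False by (subst small) (auto simp: N_def)
      have 1: "N dvd int r - (int i + 1) \<longleftrightarrow> r = i + 1"
        using r that False by (subst small) (auto simp: N_def)
      have "affine_gen n i x = q * N + int (Transposition.transpose i (i + 1) r)"
        by (simp add: affine_gen_def ow False)
      moreover have "tr (int i) (int i + 1) x = (if r = i then x + 1 else if r = i + 1 then x - 1 else x)"
        using d[of "int i"] d[of "int i + 1"] 0 1 by (simp add: tr_def)
      ultimately show ?thesis
        by (auto simp: x Transposition.transpose_def)
    qed
  qed
  have "tr c (c + 1) \<in> affine_gens n" for c
  proof -
    define i where "i = nat (c mod N)"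
    have i: "int i = c mod N" using N_ge_2 by (simp add: i_def)
    moreover have "int i < N" unfolding i using N_ge_2 by simp
    then have "i \<le> n" by (simp add: N_def)
    moreover have "N dvd c - int i" unfolding i by simp
    then have "tr (int i) (int i + 1) = tr c (c + 1)" by (rule tr_Suc_eq)
    ultimately show ?thesis using gen by (force simp: affine_gens_def)
  qed
  then show ?thesis using gen by (auto simp: affine_gens_def)
qed

text \<open>Applying the transposition of \<open>a\<close> and \<open>a + 1\<close> moves
  \<open>a\<close> up by one and does not move \<open>b\<close> up, so the gap shrinks until the two
  points are adjacent.\<close>

lemma ex_tr_conjugator:
  assumes "a < b" "\<not> N dvd b - a"
  shows "\<exists>u\<in>W. \<exists>c. u c = a \<and> u (c + 1) = b"
  using assms
proof (induction "nat (b - a)" arbitrary: a b rule: less_induct)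
  case less
  show ?case
  proof (cases "b = a + 1")
    case True
    then show ?thesis using id_in_W by (metis id_apply)
  next
    case False
    let ?s = "tr a (a + 1)"
    have s: "?s \<in> W" and ss: "?s (?s x) = x" for x
      using tr_in_W[of "a + 1" a] not_dvd_1 by simp_all
    have lt: "a + 1 < ?s b"
      using tr_Suc_less[of a b a] less.prems False by simp
    have "?s b \<le> b"
      using less.prems by (cases rule: tr_Suc_cases[of b a]) auto
    moreover have "\<not> N dvd ?s b - (a + 1)"
      using periodic_dvd_iff[OF W_periodic W_inj, OF s s, of b a] less.prems by simp
    ultimately obtain u c where u: "u \<in> W" "u c = a + 1" "u (c + 1) = ?s b"
      using less.hyps[of "?s b" "a + 1"] lt by auto
    have "?s (a + 1) = a" using ss[of a] by simp
    then have "?s \<circ> u \<in> W \<and> (?s \<circ> u) c = a \<and> (?s \<circ> u) (c + 1) = b"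
      using u s comp_in_W ss by simp
    then show ?thesis by blast
  qed
qed

text \<open>By \<open>conj_tr\<close> a conjugate of a generator is a transposition, whose points
  can be put in order by \<open>tr_commute\<close>. The converse is
  \<open>ex_tr_conjugator\<close>.\<close>

lemma reflections_eq:
  "reflections (affine_sym n) (affine_gens n) = {tr a b | a b. a < b \<and> \<not> N dvd b - a}"
proof -
  have ops: "monoid.mult (affine_sym n) = (\<circ>)" by (simp add: affine_sym_def)
  have conj: "u \<circ> tr c (c + 1) \<circ> inv\<^bsub>affine_sym n\<^esub> u = tr (u c) (u (c + 1))" if "u \<in> W" for u c
    using that W_bij[OF that]
    by (simp add: m_inv_eq fun_eq_iff conj_tr bij_is_surj surj_f_inv_f)
  have "reflections (affine_sym n) (affine_gens n) = {tr (u c) (u (c + 1)) | u c. u \<in> W}"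
    unfolding reflections_def ops affine_gens_eq W_def[symmetric]
  proof safe
    fix u c assume "u \<in> W"
    then show "\<exists>v d. u \<circ> tr c (c + 1) \<circ> inv\<^bsub>affine_sym n\<^esub> u = tr (v d) (v (d + 1)) \<and> v \<in> W"
      using conj by blast
  next
    fix u c assume "u \<in> W"
    then show "\<exists>x s. tr (u c) (u (c + 1)) = x \<circ> s \<circ> inv\<^bsub>affine_sym n\<^esub> x \<and> x \<in> W \<and> s \<in> range (\<lambda>c. tr c (c + 1))"
      using conj by (metis rangeI)
  qed
  also have "\<dots> = {tr a b | a b. a < b \<and> \<not> N dvd b - a}"
  proof safe
    fix u c assume u: "u \<in> W"
    have nd: "\<not> N dvd u (c + 1) - u c" "\<not> N dvd u c - u (c + 1)"
      using periodic_dvd_iff[OF W_periodic W_inj, OF u u, of "c + 1" c] not_dvd_1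
      by (simp_all add: dvd_diff_commute)
    then have "u c \<noteq> u (c + 1)" by auto
    then show "\<exists>a b. tr (u c) (u (c + 1)) = tr a b \<and> a < b \<and> \<not> N dvd b - a"
      using nd tr_commute by (metis linorder_neqE)
  next
    fix a b assume "a < b" "\<not> N dvd b - a"
    then show "\<exists>u c. tr a b = tr (u c) (u (c + 1)) \<and> u \<in> W"
      using ex_tr_conjugator by metis
  qed
  finally show ?thesis .
qed

subsection \<open>Descents and length\<close>

text \<open>Without descents the displacement is weakly increasing. Being periodic it is constant,
  and its sum over the window is zero.\<close>

lemma ex_descent:
  assumes "u \<in> W" "u \<noteq> id"
  shows "\<exists>c. u (c + 1) < u c"
proof (rule ccontr)
  assume *: "\<not> ?thesis"
  have "u (c + 1) \<noteq> u c" for c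
    using W_inj[OF assms(1)] by (simp add: inj_eq)
  with * have up: "u c < u (c + 1)" for c by (metis linorder_neqE)
  have step: "u c - c \<le> u (c + 1) - (c + 1)" for c using up[of c] by linarith
  have mono: "u c - c \<le> u (c + int k) - (c + int k)" for c k
  proof (induction k)
    case (Suc k)
    then show ?case using step[of "c + int k"] by (simp add: algebra_simps)
  qed simp
  have const: "u (c + 1) - (c + 1) = u c - c" for c
  proof (rule antisym)
    \<comment> \<open>Going \<open>n\<close> steps further from \<open>c + 1\<close> completes a
      period and returns to the displacement at \<open>c\<close>.\<close>
    have "u (c + 1) - (c + 1) \<le> u (c + 1 + int n) - (c + 1 + int n)" by (rule mono)
    also have "\<dots> = u (c + N) - (c + N)" by (simp add: N_def algebra_simps)
    also have "\<dots> = u c - c" using displacement_periodic W_periodic assms(1) by blast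
    finally show "u (c + 1) - (c + 1) \<le> u c - c" .
  qed (rule step)
  have c0: "u t - t = u 0" for t
  proof (induction t rule: int_induct[where k = 0])
    case (step2 i)
    then show ?case using const[of "i - 1"] by simp
  next
    case (step1 i)
    then show ?case using const[of i] by simp
  qed simp
  then have "(\<Sum>t=1..N. u t - t) = N * u 0" using N_ge_2 by simp
  then have "u 0 = 0" using assms(1) N_ge_2 by (simp add: W_iff)
  then have "u = id" using c0 by (simp add: fun_eq_iff)
  with assms(2) show False by simp
qed

text \<open>Undoing a descent strictly lowers the sum of the squared displacements.\<close>

lemma descent_induct [consumes 1, case_names id descent]:
  assumes "u \<in> W" and "P id"
    and step: "\<And>u c. u \<in> W \<Longrightarrow> u (c + 1) < u c \<Longrightarrow> P (u \<circ> tr c (c + 1)) \<Longrightarrow> P u"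
  shows "P u"
  using assms(1)
proof (induction "nat (\<Sum>t=1..N. (u t - t)\<^sup>2)" arbitrary: u rule: less_induct)
  case less
  show ?case
  proof (cases "u = id")
    case False
    then obtain c where c: "u (c + 1) < u c" using ex_descent less.prems by blast
    let ?s = "tr c (c + 1)"
    have nd: "\<not> N dvd c + 1 - c" using not_dvd_1 by simp
    have s: "?s \<in> W" using nd by (rule tr_in_W)
    have pu: "periodic u" using less.prems by (rule W_periodic)
    have "((u \<circ> ?s) (t + N) - (t + N))\<^sup>2 = ((u \<circ> ?s) t - t)\<^sup>2" for t
      using displacement_periodic[OF W_periodic[OF comp_in_W[OF less.prems s]]] by metis
    \<comment> \<open>Reindexing by \<open>?s\<close> moves the transposition from the value to the
      subtracted position, so only the classes of \<open>c\<close> and \<open>c + 1\<close> change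
      their summand.\<close>
    then have "(\<Sum>t=1..N. ((u \<circ> ?s) t - t)\<^sup>2) = (\<Sum>t=1..N. ((u \<circ> ?s) (?s t) - ?s t)\<^sup>2)"
      by (rule sum_window_reindex[OF W_periodic[OF s] W_inj[OF s], symmetric])
    also have "\<dots> = (\<Sum>t=1..N. (u t - ?s t)\<^sup>2)" using tr_tr[OF nd] by simp
    finally have e1: "(\<Sum>t=1..N. ((u \<circ> ?s) t - t)\<^sup>2) = (\<Sum>t=1..N. (u t - ?s t)\<^sup>2)" .
    have "(u t - t)\<^sup>2 - (u t - ?s t)\<^sup>2 =
      (if N dvd t - c then 2 * (u c - c) - 1 else if N dvd t - (c + 1) then 2 * c + 1 - 2 * u (c + 1) else 0)" for t
    proof (cases rule: tr_cases[OF nd, of t])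
      case (1 k)
      then show ?thesis
        using periodic_mult[OF pu] by (simp add: power2_eq_square algebra_simps)
    next
      case (2 k)
      then have "\<not> N dvd t - c"
        using not_dvd_1 by (simp add: algebra_simps)
      then show ?thesis
        using 2 periodic_mult[OF pu, of "c + 1"] by (simp add: power2_eq_square algebra_simps)
    qed simp
    \<comment> \<open>The contributions of the two classes add up to twice the height of the
      descent, which is positive.\<close>
    then have "(\<Sum>t=1..N. (u t - t)\<^sup>2) - (\<Sum>t=1..N. (u t - ?s t)\<^sup>2) = 2 * (u c - u (c + 1))"
      using sum_two_classes[OF nd] by (simp add: sum_subtractf[symmetric])
    moreover have "0 \<le> (\<Sum>t=1..N. (u t - ?s t)\<^sup>2)" by (simp add: sum_nonneg)
    ultimately have "nat (\<Sum>t=1..N. ((u \<circ> ?s) t - t)\<^sup>2) < nat (\<Sum>t=1..N. (u t - t)\<^sup>2)"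
      unfolding e1 zless_nat_conj using c by auto
    then show ?thesis
      using less.hyps step[OF less.prems c] comp_in_W[OF less.prems s] by blast
  qed (use \<open>P id\<close> in simp)
qed

section \<open>Words in the generators, strong exchange and length\<close>

definition word :: "(int \<Rightarrow> int) list \<Rightarrow> int \<Rightarrow> int" where
  "word ss = foldr (\<circ>) ss id"

lemma word_Nil [simp]: "word [] = id"
  by (simp add: word_def)

lemma word_Cons [simp]: "word (s # ss) = s \<circ> word ss"
  unfolding word_def foldr_Cons by (rule comp_apply)

lemma word_append: "word (ss @ ss') = word ss \<circ> word ss'"
  by (induction ss) (simp_all add: comp_assoc)

lemma word_exists:
  assumes "u \<in> W"
  shows "\<exists>ss. set ss \<subseteq> affine_gens n \<and> word ss = u"
  using assms
proof (induction rule: descent_induct)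
  case id
  have "set [] \<subseteq> affine_gens n \<and> word [] = id" by simp
  then show ?case by blast
next
  case (descent u c)
  then obtain ss where ss: "set ss \<subseteq> affine_gens n" "word ss = u \<circ> tr c (c + 1)" by blast
  have "word (ss @ [tr c (c + 1)]) = u"
    using ss(2) tr_comp_tr[of "c + 1" c] not_dvd_1
    by (simp add: word_append comp_assoc)
  moreover have "set (ss @ [tr c (c + 1)]) \<subseteq> affine_gens n"
    using ss(1) by (auto simp: affine_gens_eq)
  ultimately show ?case by blast
qed

lemma word_in_W: "set ss \<subseteq> affine_gens n \<Longrightarrow> word ss \<in> W"
proof (induction ss)
  case (Cons s ss)
  then obtain c where "s = tr c (c + 1)" by (auto simp: affine_gens_eq)
  then have "s \<in> W" using tr_in_W[of "c + 1" c] not_dvd_1 by simp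
  moreover have "word ss \<in> W" using Cons by simp
  ultimately show ?case unfolding word_Cons by (rule comp_in_W)
qed (simp add: id_in_W)

text \<open>Strong exchange: some letter of the word puts the images of \<open>a\<close> and \<open>b\<close> out of order for
  the first time, and deleting that letter amounts to multiplying by the transposition.\<close>

lemma strong_exchange:
  assumes "set ss \<subseteq> affine_gens n" "a < b" "\<not> N dvd b - a"
    and "word ss b < word ss a"
  shows "\<exists>ss'. set ss' \<subseteq> affine_gens n \<and> length ss' < length ss \<and>
    word ss' = word ss \<circ> tr a b"
  using assms
proof (induction ss)
  case (Cons s ss)
  let ?v = "word ss"
  have v: "?v \<in> W" using Cons.prems(1) by (intro word_in_W) simp
  obtain c where s: "s = tr c (c + 1)" using Cons.prems(1) by (auto simp: affine_gens_eq)
  have "?v a \<noteq> ?v b" using W_inj[OF v] Cons.prems(2) by (simp add: inj_eq)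
  then consider "?v b < ?v a" | "?v a < ?v b" by linarith
  then show ?case
  proof cases
    case 1
    have "set ss \<subseteq> affine_gens n" using Cons.prems(1) by simp
    from Cons.IH[OF this Cons.prems(2,3) 1]
    obtain ss' where "set ss' \<subseteq> affine_gens n" "length ss' < length ss"
      "word ss' = ?v \<circ> tr a b"
      by blast
    then show ?thesis
      using Cons.prems(1) by (intro exI[of _ "s # ss'"]) (simp add: comp_assoc)
  next
    case 2
    \<comment> \<open>The letter \<open>s\<close> reverses the order of \<open>?v a\<close> and
      \<open>?v b\<close>, which by \<open>tr_Suc_less\<close> is possible only if it exchanges
      exactly these two adjacent values.\<close>
    then have "N dvd ?v a - c \<and> ?v b = ?v a + 1"
      using tr_Suc_less[of "?v a" "?v b" c] Cons.prems(4) by (auto simp: s)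
    then have "s = tr (?v a) (?v b)" using tr_Suc_eq s by metis
    then have "s \<circ> ?v = ?v \<circ> tr a b" using comp_tr[OF v] by simp
    then have "s \<circ> ?v \<circ> tr a b = ?v" using tr_comp_tr[OF Cons.prems(3)] by (simp add: comp_assoc)
    then have "word ss = word (s # ss) \<circ> tr a b" by (simp only: word_Cons)
    moreover have "set ss \<subseteq> affine_gens n" "length ss < length (s # ss)"
      using Cons.prems(1) by simp_all
    ultimately show ?thesis by blast
  qed
qed simp

text \<open>Strong exchange is applied to a shortest word for \<open>u\<close>.\<close>

lemma cox_length_tr_less:
  assumes "u \<in> W" "a < b" "\<not> N dvd b - a" "u b < u a"
  shows "cox_length (affine_sym n) (affine_gens n) (u \<circ> tr a b)
    < cox_length (affine_sym n) (affine_gens n) u"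
proof -
  let ?Q = "\<lambda>v k. \<exists>ss. set ss \<subseteq> affine_gens n \<and> length ss = k \<and> word ss = v"
  have len: "cox_length (affine_sym n) (affine_gens n) v = (LEAST k. ?Q v k)" for v
    by (simp add: cox_length_def affine_sym_def word_def)
  have "\<exists>k. ?Q u k" using word_exists[OF assms(1)] by blast
  then have "?Q u (LEAST k. ?Q u k)" by (rule LeastI_ex)
  then obtain ss where ss: "set ss \<subseteq> affine_gens n" "length ss = (LEAST k. ?Q u k)"
    "word ss = u" by blast
  obtain ss' where "set ss' \<subseteq> affine_gens n" "length ss' < length ss"
    "word ss' = u \<circ> tr a b"
    using strong_exchange[OF ss(1) assms(2,3)] assms(4) ss(3) by auto
  moreover from this have "(LEAST k. ?Q (u \<circ> tr a b) k) \<le> length ss'"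
    by (intro Least_le) blast
  ultimately show ?thesis using ss(2) len by simp
qed

lemma cox_length_less_tr_iff:
  assumes "u \<in> W" "a < b" "\<not> N dvd b - a"
  shows "cox_length (affine_sym n) (affine_gens n) u
    < cox_length (affine_sym n) (affine_gens n) (u \<circ> tr a b) \<longleftrightarrow> u a < u b"
proof -
  have "u a \<noteq> u b" using W_inj[OF assms(1)] assms(2) by (simp add: inj_eq)
  then consider "u b < u a" | "u a < u b" by linarith
  then show ?thesis
  proof cases
    case 1
    then show ?thesis using cox_length_tr_less[OF assms] by simp
  next
    case 2
    \<comment> \<open>Here \<open>u \<circ> tr a b\<close> has \<open>a\<close> and \<open>b\<close>
      out of order, and a second multiplication by the transposition gives back
      \<open>u\<close>.\<close>
    then show ?thesis
      using cox_length_tr_less[OF comp_in_W[OF assms(1) tr_in_W[OF assms(3)]] assms(2,3)]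
        tr_comp_tr[OF assms(3)] tr_right[OF assms(3)] by (simp add: comp_assoc)
  qed
qed

abbreviation step :: "(int \<Rightarrow> int) \<Rightarrow> (int \<Rightarrow> int) \<Rightarrow> bool" where
  "step \<equiv> bruhat_step (affine_sym n) (affine_gens n)"

lemma step_iff:
  "step u v \<longleftrightarrow> u \<in> W \<and> (\<exists>a b. a < b \<and> \<not> N dvd b - a \<and> u a < u b \<and> v = u \<circ> tr a b)"
proof -
  have "monoid.mult (affine_sym n) = (\<circ>)" by (simp add: affine_sym_def)
  then show ?thesis
    unfolding bruhat_step_def reflections_eq W_def[symmetric]
    using cox_length_less_tr_iff by (simp; blast)
qed

subsection \<open>Crossing numbers\<close>

text \<open>The displacement is periodic, hence bounded by its maximum \<open>K\<close> over one
  period; this bounds crossing points from below.\<close>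

lemma finite_crossings:
  assumes "u \<in> W"
  shows "finite {x. x \<le> i \<and> j \<le> u x}"
proof -
  define K where "K = Max ((\<lambda>t. u t - t) ` {0..<N})"
  have K: "u x \<le> x + K" for x
  proof -
    have "u x - x = u (x mod N) - x mod N"
      using periodic_mult[OF W_periodic[OF assms], of "x mod N" "x div N"]
      by (simp add: algebra_simps)
    moreover have "u (x mod N) - x mod N \<le> K"
      unfolding K_def using N_ge_2 by (intro Max_ge) auto
    ultimately show ?thesis by linarith
  qed
  have "{x. x \<le> i \<and> j \<le> u x} \<subseteq> {j - K..i}"
  proof
    fix x assume "x \<in> {x. x \<le> i \<and> j \<le> u x}"
    then show "x \<in> {j - K..i}" using K[of x] by simp
  qed
  then show ?thesis by (rule finite_subset) simp
qed

lemma cross_rec: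
  assumes "u \<in> W"
  shows "cross u i j = cross u (i - 1) j + (if j \<le> u i then 1 else 0)"
proof -
  have "{x. x \<le> i \<and> j \<le> u x} = (if j \<le> u i then insert i else id) {x. x \<le> i - 1 \<and> j \<le> u x}"
    by auto (metis order_le_less zle_diff1_eq)+
  then show ?thesis
    using finite_crossings[OF assms, of "i - 1" j] by (auto simp: cross_def)
qed

text \<open>The transposition permutes the half-line up to \<open>i\<close> unless \<open>i\<close>
  is congruent to \<open>c\<close>. In that case the point \<open>i\<close> is split off;
  \<open>i - 1\<close> is then not congruent to \<open>c\<close>, since
  \<open>N \<ge> 2\<close>.\<close>

lemma cross_comp_tr:
  assumes "u \<in> W"
  shows "cross (u \<circ> tr c (c + 1)) i j =
    (if N dvd i - c then cross u (i - 1) j + (if j \<le> u (i + 1) then 1 else 0) else cross u i j)"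
proof -
  let ?s = "tr c (c + 1)"
  have nd: "\<not> N dvd c + 1 - c" using not_dvd_1 by simp
  have s: "?s \<in> W" using nd by (rule tr_in_W)
  have same: "cross (u \<circ> ?s) i j = cross u i j" if i: "\<not> N dvd i - c" for i
  proof -
    have le: "?s x \<le> i" if "x \<le> i" for x
      using that i by (cases rule: tr_Suc_cases[of x c]) (auto simp: order_le_less)
    have "{x. x \<le> i \<and> j \<le> u x} = ?s ` {x. x \<le> i \<and> j \<le> (u \<circ> ?s) x}"
    proof safe
      fix x assume "x \<le> i" "j \<le> u x"
      then show "x \<in> ?s ` {x. x \<le> i \<and> j \<le> (u \<circ> ?s) x}"
        using le tr_tr[OF nd] by (intro image_eqI[of _ _ "?s x"]) auto
    qed (use le in auto)
    then show ?thesis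
      using W_inj[OF s] by (simp add: cross_def card_image inj_on_subset)
  qed
  have "\<not> N dvd i - 1 - c" if "N dvd i - c"
    using that not_dvd_1 dvd_diff[of N "i - c" "i - 1 - c"] by auto
  then show ?thesis
    using same[of i] same[of "i - 1"] cross_rec[OF comp_in_W[OF assms s], of i j]
    by (simp add: tr_def)
qed

lemma cross_step:
  assumes "step u v"
  shows "cross u i j \<le> cross v i j"
proof -
  obtain a b where u: "u \<in> W" and ab: "a < b" "\<not> N dvd b - a" "u a < u b" and v: "v = u \<circ> tr a b"
    using assms by (auto simp: step_iff)
  note pu = periodic_mult[OF W_periodic[OF u]]
  \<comment> \<open>A point that still crosses for \<open>v\<close> is kept. A point that is lost
    has the form \<open>b + k * N\<close>; its partner \<open>a + k * N\<close> lies further left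
    and inherits its value.\<close>
  define \<phi> where "\<phi> x = (if j \<le> v x then x else tr a b x)" for x
  let ?A = "{x. x \<le> i \<and> j \<le> u x}"
  have key: "\<phi> x \<le> i \<and> j \<le> v (\<phi> x)" if "x \<le> i" "j \<le> u x" for x
    using ab(2) that by (cases rule: tr_cases[OF ab(2), of x])
      (use ab in \<open>auto simp: \<phi>_def v pu tr_shift_right\<close>)
  have "inj_on \<phi> ?A"
  proof (rule inj_onI)
    fix x y assume "x \<in> ?A" "y \<in> ?A" "\<phi> x = \<phi> y"
    \<comment> \<open>A kept \<open>x\<close> cannot collide with a moved \<open>y\<close>: then
      \<open>x = tr a b y\<close>, so \<open>v y = u x\<close> is at least \<open>j\<close> and
      \<open>y\<close> would have been kept.\<close>
    moreover have "v z = u (tr a b z)" for z by (simp add: v)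
    ultimately show "x = y"
      unfolding \<phi>_def using tr_tr[OF ab(2)] by (metis (mono_tags, lifting) mem_Collect_eq)
  qed
  moreover have "\<phi> ` ?A \<subseteq> {x. x \<le> i \<and> j \<le> v x}" using key by blast
  moreover have "v \<in> W" using u ab tr_in_W comp_in_W v by blast
  ultimately show ?thesis
    unfolding cross_def using finite_crossings by (intro card_inj_on_le)
qed

section \<open>The lifting property and the crossing number criterion\<close>

lemma step_lift:
  assumes "step\<^sup>*\<^sup>* u v"
  shows "step\<^sup>*\<^sup>* (u \<circ> tr c (c + 1)) (v \<circ> tr c (c + 1)) \<or> step\<^sup>*\<^sup>* (u \<circ> tr c (c + 1)) v"
  using assms
proof (induction rule: rtranclp_induct)
  case (step v v')
  let ?s = "tr c (c + 1)"
  obtain a b where v: "v \<in> W" and ab: "a < b" "\<not> N dvd b - a" "v a < v b" and v': "v' = v \<circ> tr a b"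
    using step by (auto simp: step_iff)
  have nd: "\<not> N dvd c + 1 - c" using not_dvd_1 by simp
  have s: "?s \<in> W" using nd by (rule tr_in_W)
  show ?case
  proof (cases "N dvd a - c \<and> b = a + 1")
    case True
    \<comment> \<open>As \<open>v \<circ> ?s\<close> is \<open>v'\<close> itself, both alternatives
      for \<open>v\<close> lead to the second alternative for \<open>v'\<close>.\<close>
    then have "v' = v \<circ> ?s" using v' tr_Suc_eq by metis
    then show ?thesis using step by (meson rtranclp.rtrancl_into_rtrancl)
  next
    case False
    \<comment> \<open>Conjugation by \<open>?s\<close> turns the step from \<open>v\<close> to
      \<open>v'\<close> into a step between the products; \<open>tr_Suc_less\<close> keeps its two
      points in order.\<close>
    have "v' \<circ> ?s = (v \<circ> ?s) \<circ> tr (?s a) (?s b)"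
      using conj_tr[OF s] tr_tr[OF nd] by (simp add: v' fun_eq_iff)
    moreover have "\<not> N dvd ?s b - ?s a"
      using ab(2) periodic_dvd_iff[OF W_periodic W_inj, OF s s] by simp
    moreover have "(v \<circ> ?s) (?s a) < (v \<circ> ?s) (?s b)" using ab(3) tr_tr[OF nd] by simp
    ultimately have "step (v \<circ> ?s) (v' \<circ> ?s)"
      unfolding step_iff using tr_Suc_less[OF ab(1) False] comp_in_W[OF v s] by blast
    then show ?thesis using step by (meson rtranclp.rtrancl_into_rtrancl)
  qed
qed simp

text \<open>A point with \<open>u x > x\<close> would be a crossing at \<open>(x, x + 1)\<close>,
  where the identity has none. So no point moves up, and zero total displacement fixes all
  points.\<close>

lemma eq_id_of_cross_le:
  assumes u: "u \<in> W" and le: "\<And>i j. cross u i j \<le> cross id i j"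
  shows "u = id"
proof -
  have "u x \<le> x" for x
  proof (rule ccontr)
    assume "\<not> u x \<le> x"
    then have "x \<in> {y. y \<le> x \<and> x + 1 \<le> u y}" by simp
    then have "0 < cross u x (x + 1)"
      using finite_crossings[OF u] unfolding cross_def by (metis card_gt_0_iff empty_iff)
    moreover have "{y. y \<le> x \<and> x + 1 \<le> id y} = {}" by auto
    then have "cross id x (x + 1) = 0" unfolding cross_def by (metis card.empty)
    ultimately show False using le by (metis not_le)
  qed
  then have nonneg: "0 \<le> t - u t" for t by simp
  show ?thesis
  proof
    fix x
    \<comment> \<open>The window is translated so that \<open>x\<close> is its first point.\<close>
    have "(\<Sum>t=1..N. (t + (x - 1)) - u (t + (x - 1))) = (\<Sum>t=1..N. t - u t)"
      by (rule sum_window_reindex)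
        (use W_periodic[OF u] in \<open>auto simp: periodic_def inj_def\<close>)
    also have "\<dots> = - (\<Sum>t=1..N. u t - t)" by (simp add: sum_negf[symmetric])
    also have "\<dots> = 0" using u by (simp add: W_iff)
    finally have "\<forall>t\<in>{1..N}. (t + (x - 1)) - u (t + (x - 1)) = 0"
      using nonneg by (subst (asm) sum_nonneg_eq_0_iff) auto
    from bspec[OF this, of 1] show "u x = id x" using N_ge_2 by simp
  qed
qed

theorem bruhat_le_iff_cross:
  assumes "u \<in> W" "v \<in> W"
  shows "bruhat_le (affine_sym n) (affine_gens n) u v \<longleftrightarrow> (\<forall>i j. cross u i j \<le> cross v i j)"
proof
  assume "bruhat_le (affine_sym n) (affine_gens n) u v"
  then have "step\<^sup>*\<^sup>* u v" by (simp add: bruhat_le_def)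
  then show "\<forall>i j. cross u i j \<le> cross v i j"
    by (induction rule: rtranclp_induct) (auto intro: order_trans dest: cross_step)
next
  assume "\<forall>i j. cross u i j \<le> cross v i j"
  with assms(2,1) have "step\<^sup>*\<^sup>* u v"
  proof (induction v arbitrary: u rule: descent_induct)
    case id
    then show ?case using eq_id_of_cross_le by blast
  next
    case (descent v c)
    let ?s = "tr c (c + 1)"
    have nd: "\<not> N dvd c + 1 - c" using not_dvd_1 by simp
    have s: "?s \<in> W" using nd by (rule tr_in_W)
    have vs: "v \<circ> ?s \<in> W" using descent.hyps s comp_in_W by blast
    have "(v \<circ> ?s) c < (v \<circ> ?s) (c + 1)" "v = (v \<circ> ?s) \<circ> ?s"
      using descent.hyps tr_right[OF nd] tr_comp_tr[OF nd] by (simp_all add: comp_assoc)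
    then have up: "step (v \<circ> ?s) v"
      unfolding step_iff using vs nd by (metis less_add_one)
    note uW = \<open>u \<in> W\<close>
    have le: "cross u i j \<le> cross v i j" for i j using descent.prems by blast
    have shift: "w (i + 1) = w (c + 1) + (i - c) \<and> w i = w c + (i - c)" if w: "w \<in> W" and dvd: "N dvd i - c" for w i
    proof -
      obtain k where "i = c + k * N" using dvd by (rule dvd_diffE)
      then show ?thesis
        using periodic_mult[OF W_periodic[OF w], of c k] periodic_mult[OF W_periodic[OF w], of "c + 1" k]
        by (simp add: algebra_simps)
    qed
    have rec2: "cross w (i + 1) j = cross w (i - 1) j + (if j \<le> w i then 1 else 0) + (if j \<le> w (i + 1) then 1 else 0)"
      if "w \<in> W" for w i j
      using cross_rec[OF that, of "i + 1" j] cross_rec[OF that, of i j] by simp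
    show ?case
    proof (cases "u (c + 1) < u c")
      case True
      have "cross (u \<circ> ?s) i j \<le> cross (v \<circ> ?s) i j" for i j
      proof (cases "N dvd i - c")
        case d: True
        \<comment> \<open>The only obstruction is equality at \<open>i - 1\<close> with
          \<open>v (i + 1) < j \<le> u (i + 1)\<close>. The descent of \<open>u\<close> then gives
          \<open>j \<le> u i\<close>, so \<open>u\<close> gains two crossings up to
          \<open>i + 1\<close> and \<open>v\<close> at most one, against the inequality
          there.\<close>
        show ?thesis
          using le[of "i - 1" j] le[of "i + 1" j] rec2[OF uW, of i j] rec2[OF descent.hyps(1), of i j]
            shift[OF uW d] True by (auto simp: cross_comp_tr uW descent.hyps(1) d split: if_splits)
      qed (simp add: cross_comp_tr uW descent.hyps(1) le)
      then have "step\<^sup>*\<^sup>* (u \<circ> ?s) (v \<circ> ?s)"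
        using descent.IH comp_in_W[OF uW s] by blast
      \<comment> \<open>Lifting by \<open>?s\<close> cancels it on the left: \<open>u\<close> lies
        below \<open>v\<close> or below \<open>v \<circ> ?s\<close>.\<close>
      then have "step\<^sup>*\<^sup>* u v \<or> step\<^sup>*\<^sup>* u (v \<circ> ?s)"
        using step_lift[of "u \<circ> ?s" "v \<circ> ?s" c] tr_comp_tr[OF nd] by (simp add: comp_assoc)
      then show ?thesis using up by (meson rtranclp.rtrancl_into_rtrancl)
    next
      case False
      have "cross u i j \<le> cross (v \<circ> ?s) i j" for i j
      proof (cases "N dvd i - c")
        case d: True
        \<comment> \<open>The same count: an obstruction needs
          \<open>v (i + 1) < j \<le> u i\<close>, and \<open>u (i + 1)\<close> is at least
          \<open>j\<close> because \<open>u\<close> has no descent here.\<close>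
        show ?thesis
          using le[of "i - 1" j] le[of "i + 1" j] rec2[OF uW, of i j] rec2[OF descent.hyps(1), of i j]
            shift[OF uW d] False cross_rec[OF uW, of i j]
          by (auto simp: cross_comp_tr descent.hyps(1) d split: if_splits)
      qed (simp add: cross_comp_tr descent.hyps(1) le)
      then have "step\<^sup>*\<^sup>* u (v \<circ> ?s)" using descent.IH uW by blast
      then show ?thesis using up by (meson rtranclp.rtrancl_into_rtrancl)
    qed
  qed
  then show "bruhat_le (affine_sym n) (affine_gens n) u v" by (simp add: bruhat_le_def)
qed

subsection \<open>Elements of the semidirect product\<close>

lemma of_window_decomp: "r \<in> {1..n + 1} \<Longrightarrow> of_window n f (q * N + int r) = q * N + f r"
  unfolding N_def by (rule of_window_eq)

lemma decomp_le_iff: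
  assumes "r \<in> {1..n + 1}" "r' \<in> {1..n + 1}"
  shows "q * N + int r \<le> q' * N + int r' \<longleftrightarrow> q < q' \<or> q = q' \<and> r \<le> r'"
proof -
  have less: "p * N + int s < p' * N + int s'" if "p < p'" "s \<in> {1..n + 1}" "s' \<in> {1..n + 1}" for p p' s s'
  proof -
    have "(p + 1) * N \<le> p' * N" using that(1) N_ge_2 by (intro mult_right_mono) auto
    then have "p * N + N \<le> p' * N" by (simp add: algebra_simps)
    moreover have "int s \<le> N" "0 < int s'" using that by (auto simp: N_def)
    ultimately show ?thesis by linarith
  qed
  show ?thesis
    using less[of q q' r r'] less[of q' q r' r] assms by (cases q q' rule: linorder_cases) auto
qed

lemma decomp_eq_iff:
  assumes "r \<in> {1..n + 1}" "r' \<in> {1..n + 1}"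
  shows "q * N + int r = q' * N + int r' \<longleftrightarrow> q = q' \<and> r = r'"
  using decomp_le_iff[OF assms, of q q'] decomp_le_iff[OF assms(2,1), of q' q] by auto

context
  fixes w :: "nat \<Rightarrow> nat" and \<mu> :: "nat \<Rightarrow> int"
  assumes carrier: "(w, \<mu>) \<in> carrier (semidirect n)"
begin

lemma w_permutes: "w permutes {1..n + 1}" and sum_\<mu>: "(\<Sum>k=1..n + 1. \<mu> k) = 0"
  using carrier by (simp_all add: semidirect_def root_lattice_def)

lemma affine_perm_decomp:
  "k \<in> {1..n + 1} \<Longrightarrow> affine_perm n (w, \<mu>) (q * N + int k) = (q + \<mu> k) * N + int (w k)"
  unfolding affine_perm_def by (subst of_window_decomp) (simp_all add: N_def algebra_simps)

lemma affine_perm_in_W: "affine_perm n (w, \<mu>) \<in> W"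
proof -
  let ?\<pi> = "affine_perm n (w, \<mu>)"
  have w: "w k \<in> {1..n + 1}" if "k \<in> {1..n + 1}" for k
    using that permutes_in_image[OF w_permutes] by blast
  have "inj ?\<pi>"
  proof (rule injI)
    fix x y assume eq: "?\<pi> x = ?\<pi> y"
    obtain q r where x: "r \<in> {1..n + 1}" "x = q * N + int r" by (rule decompE)
    obtain q' r' where y: "r' \<in> {1..n + 1}" "y = q' * N + int r'" by (rule decompE)
    have "q + \<mu> r = q' + \<mu> r' \<and> w r = w r'"
      using eq unfolding x(2) y(2) affine_perm_decomp[OF x(1)] affine_perm_decomp[OF y(1)]
      by (subst (asm) decomp_eq_iff) (use w x y in auto)
    moreover from this have "r = r'" using permutes_inj[OF w_permutes] by (simp add: inj_eq)
    ultimately show "x = y" using x y by simp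
  qed
  moreover have "y \<in> range ?\<pi>" for y
  proof -
    obtain q r where y: "r \<in> {1..n + 1}" "y = q * N + int r" by (rule decompE)
    obtain k where k: "k \<in> {1..n + 1}" "r = w k"
      using y(1) permutes_image[OF w_permutes] by blast
    have "?\<pi> ((q - \<mu> k) * N + int k) = y"
      using affine_perm_decomp[OF k(1)] k(2) y(2) by simp
    then show ?thesis by blast
  qed
  then have "surj ?\<pi>" by blast
  moreover have "periodic ?\<pi>"
    unfolding periodic_def
  proof
    fix t
    obtain q r where t: "r \<in> {1..n + 1}" "t = q * N + int r" by (rule decompE)
    have "t + N = (q + 1) * N + int r" using t(2) by (simp add: algebra_simps)
    then show "?\<pi> (t + N) = ?\<pi> t + N"
      by (simp only: t(2) affine_perm_decomp[OF t(1)]) (simp add: algebra_simps)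
  qed
  moreover have "(\<Sum>t=1..N. ?\<pi> t - t) = 0"
  proof -
    have "{1..N} = int ` {1..n + 1}" by (simp add: image_int_atLeastAtMost N_def)
    then have "(\<Sum>t=1..N. ?\<pi> t - t) = (\<Sum>k=1..n + 1. ?\<pi> (int k) - int k)"
      by (simp add: sum.reindex del: sum.cl_ivl_Suc)
    also have "\<dots> = (\<Sum>k=1..n + 1. \<mu> k * N + (int (w k) - int k))"
      using affine_perm_decomp[of _ 0] by (intro sum.cong) simp_all
    \<comment> \<open>The translation part contributes \<open>N\<close> times the sum of
      \<open>\<mu>\<close>, and the permutation part cancels; both vanish.\<close>
    also have "\<dots> = (\<Sum>k=1..n + 1. \<mu> k) * N + ((\<Sum>k=1..n + 1. int (w k)) - (\<Sum>k=1..n + 1. int k))"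
      by (simp only: sum.distrib sum_subtractf sum_distrib_right)
    also have "(\<Sum>k=1..n + 1. int (w k)) = (\<Sum>k=1..n + 1. int k)"
      using sum.permute[OF w_permutes, of int] by (simp add: comp_def del: sum.cl_ivl_Suc)
    finally show ?thesis using sum_\<mu> by simp
  qed
  ultimately show ?thesis by (simp add: W_iff bij_def)
qed

text \<open>The points of residue \<open>k\<close> counted by the crossing number form an interval, which is empty
  when the summand is negative.\<close>

lemma cross_affine_perm:
  assumes i: "i \<in> {1..n + 1}" and j: "j \<in> {1..n + 1}"
  shows "int (cross (affine_perm n (w, \<mu>)) (int i + m * N) (int j)) =
    (\<Sum>k=1..n + 1. max 0 (m + (\<mu> k + fund_weight i k
      - perm_act (inv_into UNIV w) (fund_weight (j - 1)) k)))"
proof -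
  let ?\<pi> = "affine_perm n (w, \<mu>)"
  \<comment> \<open>For residue \<open>k\<close>, block \<open>q\<close> is counted when
    \<open>q + \<mu> k\<close> is at least 0, or 1 if \<open>w k < j\<close>, and \<open>q\<close>
    is at most \<open>m\<close>, or \<open>m - 1\<close> if \<open>k > i\<close>. The length
    \<open>hi k - lo k + 1\<close> is the argument of the maximum.\<close>
  define lo where "lo k = (if j \<le> w k then 0 else 1) - \<mu> k" for k
  define hi where "hi k = m - 1 + (if k \<le> i then 1 else 0)" for k
  let ?S = "SIGMA k:{1..n + 1}. {lo k..hi k}"
  let ?f = "\<lambda>(k, q). q * N + int k"
  have w: "w k \<in> {1..n + 1}" if "k \<in> {1..n + 1}" for k
    using that permutes_in_image[OF w_permutes] by blast
  have mem: "q * N + int k \<le> int i + m * N \<and> int j \<le> ?\<pi> (q * N + int k) \<longleftrightarrow> q \<in> {lo k..hi k}"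
    if k: "k \<in> {1..n + 1}" for k q
  proof -
    have "q * N + int k \<le> int i + m * N \<longleftrightarrow> q \<le> hi k"
      using decomp_le_iff[OF k i, of q m] by (auto simp: hi_def add.commute)
    moreover have "int j \<le> ?\<pi> (q * N + int k) \<longleftrightarrow> lo k \<le> q"
      using decomp_le_iff[OF j w[OF k], of 0 "q + \<mu> k"]
      by (auto simp: lo_def affine_perm_decomp[OF k])
    ultimately show ?thesis by auto
  qed
  have "{x. x \<le> int i + m * N \<and> int j \<le> ?\<pi> x} = ?f ` ?S"
  proof (intro equalityI subsetI)
    fix x assume x: "x \<in> {x. x \<le> int i + m * N \<and> int j \<le> ?\<pi> x}"
    obtain q k where k: "k \<in> {1..n + 1}" "x = q * N + int k" by (rule decompE)
    then have "(k, q) \<in> ?S" using x mem[OF k(1), of q] by simp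
    then show "x \<in> ?f ` ?S" using k(2) by force
  next
    fix x assume "x \<in> ?f ` ?S"
    then obtain k q where k: "k \<in> {1..n + 1}" "q \<in> {lo k..hi k}" "x = q * N + int k" by auto
    then show "x \<in> {x. x \<le> int i + m * N \<and> int j \<le> ?\<pi> x}" using mem[OF k(1), of q] by blast
  qed
  moreover have "inj_on ?f ?S"
    by (rule inj_onI) (clarsimp simp: decomp_eq_iff simp del: One_nat_def)
  ultimately have "cross ?\<pi> (int i + m * N) (int j) = card ?S"
    unfolding cross_def by (simp only: card_image)
  also have "\<dots> = (\<Sum>k=1..n + 1. card {lo k..hi k})" by (simp del: sum.cl_ivl_Suc)
  finally have "int (cross ?\<pi> (int i + m * N) (int j)) = (\<Sum>k=1..n + 1. int (card {lo k..hi k}))"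
    by (simp del: sum.cl_ivl_Suc)
  also have "\<dots> = (\<Sum>k=1..n + 1. max 0 (m + (\<mu> k + fund_weight i k
      - perm_act (inv_into UNIV w) (fund_weight (j - 1)) k)))"
  proof (rule sum.cong)
    fix k assume k: "k \<in> {1..n + 1}"
    have "perm_act (inv_into UNIV w) (fund_weight (j - 1)) k = fund_weight (j - 1) (w k)"
      by (simp add: perm_act_def inv_inv_eq permutes_bij[OF w_permutes])
    then show "int (card {lo k..hi k}) = max 0 (m + (\<mu> k + fund_weight i k
      - perm_act (inv_into UNIV w) (fund_weight (j - 1)) k))"
      using k w[OF k] j by (auto simp: lo_def hi_def fund_weight_def)
  qed simp
  finally show ?thesis .
qed

end

section \<open>Reduction of crossing numbers to the window\<close>

lemma cross_translate:
  assumes "u \<in> W"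
  shows "cross u (i + k * N) (j + k * N) = cross u i j"
proof -
  have "{x. x \<le> i + k * N \<and> j + k * N \<le> u x} = (\<lambda>x. x + k * N) ` {x. x \<le> i \<and> j \<le> u x}"
  proof safe
    fix x assume "x \<le> i + k * N" "j + k * N \<le> u x"
    then show "x \<in> (\<lambda>x. x + k * N) ` {x. x \<le> i \<and> j \<le> u x}"
      using periodic_mult[OF W_periodic[OF assms], of "x - k * N" k]
      by (intro image_eqI[of _ _ "x - k * N"]) auto
  qed (use periodic_mult[OF W_periodic[OF assms]] in auto)
  then show ?thesis by (simp add: cross_def card_image)
qed

lemma cross_le_iff_window:
  assumes "u \<in> W" "v \<in> W"
  shows "(\<forall>i j. cross u i j \<le> cross v i j) \<longleftrightarrow>
    (\<forall>i\<in>{1..n + 1}. \<forall>j\<in>{1..n + 1}. \<forall>m.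
      cross u (int i + m * N) (int j) \<le> cross v (int i + m * N) (int j))" (is "?L \<longleftrightarrow> ?R")
proof
  assume R: ?R
  show ?L
  proof (intro allI)
    fix i j
    obtain p s where j: "s \<in> {1..n + 1}" "j = p * N + int s" by (rule decompE)
    obtain q r where i: "r \<in> {1..n + 1}" "i = q * N + int r" by (rule decompE)
    \<comment> \<open>Translating by \<open>p\<close> blocks brings \<open>j\<close> into the
      window; \<open>i\<close> keeps the offset \<open>m = q - p\<close>, which is why
      \<open>m\<close> ranges over all integers.\<close>
    have "i = int r + (q - p) * N + p * N" "j = int s + p * N"
      using i j by (simp_all add: algebra_simps)
    then show "cross u i j \<le> cross v i j"
      using R i j cross_translate assms by metis
  qed
qed blast

end

subsection \<open>Dominance order\<close>

text \<open>With \<open>sum_initial_eq_excess\<close> this presents the sum of positive parts of a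
  decreasing sequence as its largest initial sum, which links excesses to dominance.\<close>

lemma sum_initial_le_excess:
  fixes f :: "nat \<Rightarrow> int"
  assumes "p \<le> L"
  shows "(\<Sum>k=1..p. m + f k) \<le> (\<Sum>k=1..L. max 0 (m + f k))"
proof -
  have "(\<Sum>k=1..p. m + f k) \<le> (\<Sum>k=1..p. max 0 (m + f k))" by (rule sum_mono) simp
  also have "\<dots> \<le> (\<Sum>k=1..L. max 0 (m + f k))" by (rule sum_mono2) (use assms in auto)
  finally show ?thesis .
qed

lemma sum_initial_eq_excess:
  fixes f :: "nat \<Rightarrow> int"
  assumes "p \<le> L" "\<And>k. k \<in> {1..p} \<Longrightarrow> 0 \<le> m + f k" "\<And>k. k \<in> {p<..L} \<Longrightarrow> m + f k \<le> 0"
  shows "(\<Sum>k=1..p. m + f k) = (\<Sum>k=1..L. max 0 (m + f k))"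
proof -
  have "(\<Sum>k=1..L. max 0 (m + f k)) = (\<Sum>k=1..p. max 0 (m + f k))"
    by (rule sum.mono_neutral_right) (use assms in auto)
  also have "\<dots> = (\<Sum>k=1..p. m + f k)" by (rule sum.cong) (use assms in auto)
  finally show ?thesis by simp
qed

lemma dominance_le_iff_excess:
  assumes f: "\<And>i j. i \<in> {1..n + 1} \<Longrightarrow> j \<in> {1..n + 1} \<Longrightarrow> i \<le> j \<Longrightarrow> f j \<le> f i"
    and g: "\<And>i j. i \<in> {1..n + 1} \<Longrightarrow> j \<in> {1..n + 1} \<Longrightarrow> i \<le> j \<Longrightarrow> g j \<le> g i"
    and sums: "(\<Sum>k=1..n + 1. f k) = (\<Sum>k=1..n + 1. g k)"
  shows "dominance_le n f g \<longleftrightarrow>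
    (\<forall>m. (\<Sum>k=1..n + 1. max 0 (m + f k)) \<le> (\<Sum>k=1..n + 1. max 0 (m + g k)))"
proof
  assume dom: "dominance_le n f g"
  show "\<forall>m. (\<Sum>k=1..n + 1. max 0 (m + f k)) \<le> (\<Sum>k=1..n + 1. max 0 (m + g k))"
  proof
    fix m
    define A where "A = {k \<in> {1..n + 1}. 0 < m + f k}"
    \<comment> \<open>The last index with a positive summand, or 0 if there is none; inserting 0
      keeps the maximum defined.\<close>
    define p where "p = Max (insert 0 A)"
    have fin: "finite (insert 0 A)" by (simp add: A_def)
    have p: "p \<in> insert 0 A" unfolding p_def using fin by (rule Max_in) simp
    then have pn: "p \<le> n + 1" by (auto simp: A_def)
    have "(\<Sum>k=1..p. m + f k) = (\<Sum>k=1..n + 1. max 0 (m + f k))"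
    proof (rule sum_initial_eq_excess[OF pn])
      fix k assume k: "k \<in> {1..p}"
      then have "p \<in> A" using p by auto
      then show "0 \<le> m + f k" using f[of k p] k by (auto simp: A_def)
    next
      fix k assume k: "k \<in> {p<..n + 1}"
      then have "k \<notin> A" using Max_ge[OF fin, of k] by (auto simp: p_def)
      then show "m + f k \<le> 0" using k by (auto simp: A_def)
    qed
    moreover have "(\<Sum>k=1..p. f k) \<le> (\<Sum>k=1..p. g k)"
      using dom pn by (cases "p = 0") (auto simp: dominance_le_def)
    then have "(\<Sum>k=1..p. m + f k) \<le> (\<Sum>k=1..p. m + g k)" by (simp add: sum.distrib)
    moreover have "\<dots> \<le> (\<Sum>k=1..n + 1. max 0 (m + g k))" by (rule sum_initial_le_excess[OF pn])
    ultimately show "(\<Sum>k=1..n + 1. max 0 (m + f k)) \<le> (\<Sum>k=1..n + 1. max 0 (m + g k))" by linarith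
  qed
next
  assume le: "\<forall>m. (\<Sum>k=1..n + 1. max 0 (m + f k)) \<le> (\<Sum>k=1..n + 1. max 0 (m + g k))"
  have "(\<Sum>k=1..p. f k) \<le> (\<Sum>k=1..p. g k)" if p: "p \<in> {1..n + 1}" for p
  proof -
    have pn: "p \<le> n + 1" using p by simp
    \<comment> \<open>With \<open>m = - g p\<close> the summands for \<open>g\<close> change sign at
      \<open>p\<close>, so its excess equals its initial sum.\<close>
    have "(\<Sum>k=1..p. - g p + f k) \<le> (\<Sum>k=1..n + 1. max 0 (- g p + f k))"
      by (rule sum_initial_le_excess[OF pn])
    also have "\<dots> \<le> (\<Sum>k=1..n + 1. max 0 (- g p + g k))" using le by blast
    also have "\<dots> = (\<Sum>k=1..p. - g p + g k)"
      by (rule sum_initial_eq_excess[OF pn, symmetric]) (use g p in auto)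
    finally show ?thesis by (simp only: sum.distrib add_le_cancel_left)
  qed
  then show "dominance_le n f g" using sums by (simp add: dominance_le_def)
qed

lemma is_dom_of_dom_rearr: "is_dom_of n \<mu> (dom_rearr n \<mu>)"
  unfolding dom_rearr_def by (rule theI'[OF ex1_is_dom_of])

text \<open>A general \<open>h\<close> serves both the totals and the excesses.\<close>

lemma sum_dom_rearr: "(\<Sum>k=1..n + 1. h (dom_rearr n \<mu> k)) = (\<Sum>k=1..n + 1. h (\<mu> k))"
proof -
  obtain \<sigma> where \<sigma>: "\<sigma> permutes {1..n + 1}" "\<forall>i\<in>{1..n + 1}. dom_rearr n \<mu> i = \<mu> (\<sigma> i)"
    using is_dom_of_dom_rearr[of n \<mu>] unfolding is_dom_of_def by blast
  have "(\<Sum>k=1..n + 1. h (dom_rearr n \<mu> k)) = (\<Sum>k=1..n + 1. ((\<lambda>k. h (\<mu> k)) \<circ> \<sigma>) k)"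
    using \<sigma>(2) by (intro sum.cong) simp_all
  also have "\<dots> = (\<Sum>k=1..n + 1. h (\<mu> k))" by (rule sum.permute[OF \<sigma>(1), symmetric])
  finally show ?thesis .
qed

lemma dominance_le_dom_rearr_iff:
  assumes "(\<Sum>k=1..n + 1. f k) = (\<Sum>k=1..n + 1. g k)"
  shows "dominance_le n (dom_rearr n f) (dom_rearr n g) \<longleftrightarrow>
    (\<forall>m. (\<Sum>k=1..n + 1. max 0 (m + f k)) \<le> (\<Sum>k=1..n + 1. max 0 (m + g k)))"
proof -
  have anti: "dom_rearr n h j \<le> dom_rearr n h i"
    if "i \<in> {1..n + 1}" "j \<in> {1..n + 1}" "i \<le> j" for h i j
    using is_dom_of_dom_rearr[of n h] that unfolding is_dom_of_def by blast
  show ?thesis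
    using dominance_le_iff_excess[of n "dom_rearr n f" "dom_rearr n g", OF anti anti]
      sum_dom_rearr[of "\<lambda>x. x" n] sum_dom_rearr[of "\<lambda>x. max 0 (_ + x)" n] assms
    by simp
qed

theorem theorem6p4:
  fixes n :: nat and w\<^sub>1 w\<^sub>2 :: "nat \<Rightarrow> nat" and \<mu>\<^sub>1 \<mu>\<^sub>2 :: "nat \<Rightarrow> int"
  assumes "n \<ge> 1"
    and "(w\<^sub>1, \<mu>\<^sub>1) \<in> carrier (semidirect n)"
    and "(w\<^sub>2, \<mu>\<^sub>2) \<in> carrier (semidirect n)"
  shows "bruhat_semidirect n (w\<^sub>1, \<mu>\<^sub>1) (w\<^sub>2, \<mu>\<^sub>2) \<longleftrightarrow>
    (\<forall>i\<in>{1..n+1}. \<forall>j\<in>{1..n+1}.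
      dominance_le n
        (dom_rearr n (\<lambda>k. \<mu>\<^sub>1 k + fund_weight i k
          - perm_act (inv_into UNIV w\<^sub>1) (fund_weight (j - 1)) k))
        (dom_rearr n (\<lambda>k. \<mu>\<^sub>2 k + fund_weight i k
          - perm_act (inv_into UNIV w\<^sub>2) (fund_weight (j - 1)) k)))"
proof -
  interpret affine_symmetric n using assms(1) by unfold_locales
  let ?\<nu> = "\<lambda>w \<mu> i j k. \<mu> k + fund_weight i k - perm_act (inv_into UNIV w) (fund_weight (j - 1)) k"
  \<comment> \<open>The total depends on neither \<open>w\<close> nor \<open>\<mu>\<close>, so the
    equal-sum condition of dominance holds automatically.\<close>
  have total: "(\<Sum>k=1..n + 1. ?\<nu> w \<mu> i j k) = (\<Sum>k=1..n + 1. fund_weight i k) - (\<Sum>k=1..n + 1. fund_weight (j - 1) k)"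
    if "(w, \<mu>) \<in> carrier (semidirect n)" for w \<mu> i j
  proof -
    have w: "w permutes {1..n + 1}" using that by (rule w_permutes)
    have "(\<Sum>k=1..n + 1. perm_act (inv_into UNIV w) (fund_weight (j - 1)) k)
      = (\<Sum>k=1..n + 1. (fund_weight (j - 1) \<circ> w) k)"
      by (simp add: perm_act_def inv_inv_eq permutes_bij[OF w] del: sum.cl_ivl_Suc)
    also have "\<dots> = (\<Sum>k=1..n + 1. fund_weight (j - 1) k)"
      by (rule sum.permute[OF w, symmetric])
    finally show ?thesis
      using sum_\<mu>[OF that] by (simp only: sum.distrib sum_subtractf)
  qed
  note W = affine_perm_in_W[OF assms(2)] affine_perm_in_W[OF assms(3)]
  have "dominance_le n (dom_rearr n (?\<nu> w\<^sub>1 \<mu>\<^sub>1 i j)) (dom_rearr n (?\<nu> w\<^sub>2 \<mu>\<^sub>2 i j)) \<longleftrightarrow>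
    (\<forall>m. cross (affine_perm n (w\<^sub>1, \<mu>\<^sub>1)) (int i + m * N) (int j)
      \<le> cross (affine_perm n (w\<^sub>2, \<mu>\<^sub>2)) (int i + m * N) (int j))"
    if "i \<in> {1..n + 1}" "j \<in> {1..n + 1}" for i j
    unfolding dominance_le_dom_rearr_iff[OF trans[OF total[OF assms(2)] total[OF assms(3), symmetric]]]
    by (simp only: cross_affine_perm[OF assms(2) that, symmetric] cross_affine_perm[OF assms(3) that, symmetric]
      of_nat_le_iff)
  then show ?thesis
    unfolding bruhat_semidirect_def bruhat_le_iff_cross[OF W] cross_le_iff_window[OF W]
    by blast
qed

end
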